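(* Let $C=\langle\tau\rangle\subseteq S$ be a cyclic subgroup of $G$ which is a group support of $\phi$, i.e. $\phi(\sigma)=0$ for all $\sigma\in S\setminus C$ and $\phi(\sigma)\neq 0$ for all $\sigma\in C$. Let $\gamma\in\Delta$ and let $\sim^\ast_\gamma$ be the equivalence relation on $C$ given by $\sigma_1\sim^\ast_\gamma\sigma_2\iff\sigma_1\sigma_2^{-1}\in G_\gamma$; suppose $C/\!\sim^\ast_\gamma\,=\{[\tau],[\tau^2],\dots,[\tau^{t_\gamma}]\}$ (with $t_\gamma$ distinct classes). For $0\le j\le t_\gamma-1$ put $v_j=\sum_{h\in C\cap G_\gamma}\phi(h\tau^{t_\gamma-j})$ and let $$d_\gamma=\left|\left\{s\in\{0,1,\dots,t_\gamma-1\}\ \middle|\ \sum_{j=0}^{t_\gamma-1}v_j\,e^{\frac{2\pi s j i}{t_\gamma}}=0\right\}\right|.$$ Then $t_\gamma=\frac{|C|}{|C\cap G_\gamma|}$ and $\dim\big(V^\phi_\gamma(C)\big)=t_\gamma-d_\gamma$.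
   Context: $G$ is a subgroup of the symmetric group $S_m$ with identity $e$; $S\subseteq G$ is a subset containing $e$ and $\phi:S\to\mathbb{C}$ is a function. $V$ is a $k$-dimensional complex inner product space with orthonormal basis $e_1,\dots,e_k$. $\Gamma^m_k$ is the set of sequences $\alpha=(\alpha_1,\dots,\alpha_m)$ with $1\le\alpha_i\le k$; $G$ acts on it by $\alpha\sigma=(\alpha_{\sigma(1)},\dots,\alpha_{\sigma(m)})$ and $G_\alpha=\{\sigma\in G:\alpha\sigma=\alpha\}$. $\Delta$ is a set of representatives of the $G$-orbits on $\Gamma^m_k$. For $\alpha\in\Gamma^m_k$, $e_\alpha=e_{\alpha_1}\otimes\cdots\otimes e_{\alpha_m}\in V^{\otimes m}$ and $$e^\phi_\alpha=\frac{\phi(e)}{|S|}\sum_{\sigma\in S}\phi(\sigma)e_{\alpha\sigma^{-1}}.$$ $V^\phi_\gamma(C)$ denotes the linear span of $\{e^\phi_{\gamma g}: g\in C\}$. In exponents $e^{\frac{2\pi sji}{t_\gamma}}$, $e$ is Euler's number and $i=\sqrt{-1}$. *)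

theory Defs
  imports
    Complex_Main
    "HOL-Library.FuncSet"
    "HOL-Library.Function_Algebras"
    "HOL-Algebra.Sym_Groups"
begin

locale complex_inner_product_space = vector_space scale
  for scale :: "complex \<Rightarrow> 'v::ab_group_add \<Rightarrow> 'v" +
  fixes ip :: "'v \<Rightarrow> 'v \<Rightarrow> complex"
  assumes ip_add_left: "ip (x + y) z = ip x z + ip y z"
    and ip_scale_left: "ip (scale c x) y = c * ip x y"
    and ip_cnj: "ip y x = cnj (ip x y)"
    and ip_pos: "x \<noteq> 0 \<Longrightarrow> 0 < Re (ip x x)"

definition orthonormal_basis ::
  "(complex \<Rightarrow> 'v::ab_group_add \<Rightarrow> 'v) \<Rightarrow> ('v \<Rightarrow> 'v \<Rightarrow> complex) \<Rightarrow> nat \<Rightarrow> (nat \<Rightarrow> 'v) \<Rightarrow> bool"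
  where "orthonormal_basis scale ip k e \<longleftrightarrow>
    (\<forall>i\<in>{1..k}. \<forall>j\<in>{1..k}. ip (e i) (e j) = (if i = j then 1 else 0)) \<and>
    module.span scale (e ` {1..k}) = UNIV"

text \<open>The tensor power \<open>V\<^sup>\<otimes>\<^sup>m\<close> is realised inside the dual of the space of \<open>m\<close>-linear forms on
  \<open>V\<close>: the tensor \<open>v\<^sub>1 \<otimes> \<dots> \<otimes> v\<^sub>m\<close> is evaluation at \<open>(v\<^sub>1, \<dots>, v\<^sub>m)\<close>, and \<open>V\<^sup>\<otimes>\<^sup>m\<close> is the span of
  these evaluations (over a field, this has the universal property of the tensor power).
  Since HOL functions are total, a functional is given the value \<open>0\<close> at functions that are not
  \<open>m\<close>-linear forms. An \<open>m\<close>-tuple of vectors is an element of \<open>{1..m} \<rightarrow>\<^sub>E UNIV\<close>.\<close>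

definition multilinear_form ::
  "(complex \<Rightarrow> 'v::ab_group_add \<Rightarrow> 'v) \<Rightarrow> nat \<Rightarrow> ((nat \<Rightarrow> 'v) \<Rightarrow> complex) \<Rightarrow> bool"
  where "multilinear_form scale m f \<longleftrightarrow>
    (\<forall>v \<in> {1..m} \<rightarrow>\<^sub>E UNIV. \<forall>i\<in>{1..m}. Vector_Spaces.linear scale (*) (\<lambda>x. f (v(i := x))))"

type_synonym 'v tensor = "((nat \<Rightarrow> 'v) \<Rightarrow> complex) \<Rightarrow> complex"

definition tensor_scale :: "complex \<Rightarrow> 'v tensor \<Rightarrow> 'v tensor"
  where "tensor_scale c T = (\<lambda>f. c * T f)"

definition tensor ::
  "(complex \<Rightarrow> 'v::ab_group_add \<Rightarrow> 'v) \<Rightarrow> nat \<Rightarrow> (nat \<Rightarrow> 'v) \<Rightarrow> 'v tensor"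
  where "tensor scale m v =
    (\<lambda>f. if multilinear_form scale m f then f (restrict v {1..m}) else 0)"

lemma vector_space_tensor_scale: "vector_space tensor_scale"
  by unfold_locales (auto simp: tensor_scale_def fun_eq_iff algebra_simps)

definition index_seqs :: "nat \<Rightarrow> nat \<Rightarrow> (nat \<Rightarrow> nat) set"
  where "index_seqs m k = {1..m} \<rightarrow>\<^sub>E {1..k}"

text \<open>A permutation of \<open>{1..m}\<close> fixes every number outside \<open>{1..m}\<close>, so \<open>\<alpha> \<circ> \<sigma>\<close> is again in
  \<open>index_seqs m k\<close>; it is the sequence \<open>\<alpha>\<sigma>\<close>.\<close>

definition seq_stabilizer :: "(nat \<Rightarrow> nat) set \<Rightarrow> (nat \<Rightarrow> nat) \<Rightarrow> (nat \<Rightarrow> nat) set"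
  where "seq_stabilizer G \<alpha> = {\<sigma>\<in>G. \<alpha> \<circ> \<sigma> = \<alpha>}"

definition orbit_representatives ::
  "(nat \<Rightarrow> nat) set \<Rightarrow> nat \<Rightarrow> nat \<Rightarrow> (nat \<Rightarrow> nat) set \<Rightarrow> bool"
  where "orbit_representatives G m k \<Delta> \<longleftrightarrow>
    \<Delta> \<subseteq> index_seqs m k \<and>
    (\<forall>\<alpha>\<in>index_seqs m k. \<exists>!\<delta>. \<delta> \<in> \<Delta> \<and> \<delta> \<in> {\<alpha> \<circ> \<sigma> | \<sigma>. \<sigma> \<in> G})"

definition basis_tensor ::
  "(complex \<Rightarrow> 'v::ab_group_add \<Rightarrow> 'v) \<Rightarrow> nat \<Rightarrow> (nat \<Rightarrow> 'v) \<Rightarrow> (nat \<Rightarrow> nat) \<Rightarrow> 'v tensor"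
  where "basis_tensor scale m e \<alpha> = tensor scale m (\<lambda>i. e (\<alpha> i))"

definition sym_tensor ::
  "(complex \<Rightarrow> 'v::ab_group_add \<Rightarrow> 'v) \<Rightarrow> nat \<Rightarrow> (nat \<Rightarrow> 'v) \<Rightarrow>
    (nat \<Rightarrow> nat) set \<Rightarrow> ((nat \<Rightarrow> nat) \<Rightarrow> complex) \<Rightarrow> (nat \<Rightarrow> nat) \<Rightarrow> 'v tensor"
  where "sym_tensor scale m e S \<phi> \<alpha> =
    tensor_scale (\<phi> id / of_nat (card S))
      (\<Sum>\<sigma>\<in>S. tensor_scale (\<phi> \<sigma>) (basis_tensor scale m e (\<alpha> \<circ> inv' \<sigma>)))"

definition orbital_subspace ::
  "(complex \<Rightarrow> 'v::ab_group_add \<Rightarrow> 'v) \<Rightarrow> nat \<Rightarrow> (nat \<Rightarrow> 'v) \<Rightarrow>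
    (nat \<Rightarrow> nat) set \<Rightarrow> ((nat \<Rightarrow> nat) \<Rightarrow> complex) \<Rightarrow> (nat \<Rightarrow> nat) \<Rightarrow> (nat \<Rightarrow> nat) set \<Rightarrow> 'v tensor set"
  where "orbital_subspace scale m e S \<phi> \<gamma> C =
    module.span tensor_scale {sym_tensor scale m e S \<phi> (\<gamma> \<circ> g) | g. g \<in> C}"

definition group_support ::
  "(nat \<Rightarrow> nat) set \<Rightarrow> ((nat \<Rightarrow> nat) \<Rightarrow> complex) \<Rightarrow> (nat \<Rightarrow> nat) set \<Rightarrow> bool"
  where "group_support S \<phi> C \<longleftrightarrow>
    C \<subseteq> S \<and> (\<forall>\<sigma>\<in>S - C. \<phi> \<sigma> = 0) \<and> (\<forall>\<sigma>\<in>C. \<phi> \<sigma> \<noteq> 0)"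

definition coset_rel ::
  "(nat \<Rightarrow> nat) set \<Rightarrow> (nat \<Rightarrow> nat) set \<Rightarrow> (nat \<Rightarrow> nat) \<Rightarrow> ((nat \<Rightarrow> nat) \<times> (nat \<Rightarrow> nat)) set"
  where "coset_rel G C \<gamma> =
    {(\<sigma>\<^sub>1, \<sigma>\<^sub>2). \<sigma>\<^sub>1 \<in> C \<and> \<sigma>\<^sub>2 \<in> C \<and> \<sigma>\<^sub>1 \<circ> inv' \<sigma>\<^sub>2 \<in> seq_stabilizer G \<gamma>}"

end

theory Submission
  imports Defs
begin

text \<open>
  Two elements of \<open>C\<close> are equivalent exactly when they send \<open>\<gamma>\<close> to the same sequence, so the
  hypothesis on the classes says that \<open>\<gamma>\<tau>, \<dots>, \<gamma>\<tau>\<^sup>t\<close> lists the orbit of \<open>\<gamma>\<close> under \<open>C\<close> without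
  repetition. It follows that \<open>\<gamma>\<tau>\<^sup>t = \<gamma>\<close>, and that every element of \<open>C\<close> is \<open>h\<tau>\<^bsup>t-j\<^esup>\<close> for a unique
  \<open>h\<close> in \<open>H = C \<inter> G\<^sub>\<gamma>\<close> and a unique \<open>j < t\<close> (\<open>coset_decomposition\<close>). Counting gives \<open>|C| = t|H|\<close>.

  Put \<open>w\<^sub>n\<close> for the basis tensor of \<open>\<gamma>\<tau>\<^sup>n\<close>; it depends only on \<open>n\<close> modulo \<open>t\<close>. Because \<open>C\<close> is
  commutative, the inverse of \<open>h\<tau>\<^bsup>t-j\<^esup>\<close> sends \<open>\<gamma>\<tau>\<^sup>i\<close> to \<open>\<gamma>\<tau>\<^bsup>i+j\<^esup>\<close>. Collecting the terms of the
  symmetrized tensor of \<open>\<gamma>\<tau>\<^sup>i\<close> by cosets of \<open>H\<close> therefore gives a nonzero multiple of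
  \<open>\<Sum>\<^sub>j v\<^sub>j w\<^bsub>i+j\<^esub>\<close> (\<open>sym_tensor_circulant\<close>): the spanning family of the orbital subspace arises
  from \<open>w\<^sub>0, \<dots>, w\<^bsub>t-1\<^esub>\<close> by a circulant matrix.

  Distinct basis tensors are linearly independent, since products of coordinate functionals
  separate them (\<open>basis_tensors_independent\<close>). The dimension is thus the rank of the circulant
  matrix. The discrete Fourier transform is invertible and diagonalises circulant matrices, with
  eigenvalues \<open>\<Sum>\<^sub>j v\<^sub>j exp (2\<pi>isj/t)\<close> for \<open>0 \<le> s < t\<close>, so the rank is the number of nonzero ones
  (\<open>dim_span_circulant\<close>), which is \<open>t - d\<close>.
\<close>

section \<open>Sums of roots of unity\<close>

definition unity_root :: "nat \<Rightarrow> int \<Rightarrow> complex"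
  where "unity_root t a = cis (2 * pi * of_int a / of_nat t)"

lemma unity_root_add: "unity_root t (a + b) = unity_root t a * unity_root t b"
  by (simp add: unity_root_def cis_mult add_divide_distrib algebra_simps)

lemma unity_root_power: "unity_root t a ^ n = unity_root t (int n * a)"
  by (simp add: unity_root_def DeMoivre algebra_simps)

lemma unity_root_multiple:
  assumes "t > 0"
  shows "unity_root t (int t * a) = 1"
proof -
  have "2 * pi * of_int (int t * a) / of_nat t = 2 * pi * of_int a"
    using assms by simp
  thus ?thesis unfolding unity_root_def by (simp only: cis_multiple_2pi Ints_of_int)
qed

lemma unity_root_eq_1D:
  assumes "t > 0" and "unity_root t a = 1"
  shows "int t dvd a"
proof -
  have "cos (2 * pi * of_int a / of_nat t) = 1"
    using assms(2) by (simp add: unity_root_def complex_eq_iff)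
  then obtain n :: int where "2 * pi * of_int a / of_nat t = of_int n * 2 * pi"
    unfolding cos_one_2pi_int by blast
  hence "real_of_int a = real_of_int (int t * n)"
    using assms(1) by (simp add: field_simps)
  thus ?thesis
    by (simp only: of_int_eq_iff) simp
qed

lemma sum_unity_root:
  assumes "t > 0"
  shows "(\<Sum>s<t. unity_root t (int s * a)) = (if int t dvd a then of_nat t else 0)"
proof (cases "unity_root t a = 1")
  case True
  hence "int t dvd a" by (rule unity_root_eq_1D[OF assms])
  thus ?thesis using True by (simp flip: unity_root_power)
next
  case False
  hence "\<not> int t dvd a"
    using unity_root_multiple[OF assms] by (auto elim!: dvdE)
  moreover have "(\<Sum>s<t. unity_root t a ^ s) = 0"
    using False unity_root_multiple[OF assms, of a]
    by (simp add: geometric_sum) (simp add: unity_root_power)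
  ultimately show ?thesis by (simp add: unity_root_power)
qed

lemma exp_eq_unity_root:
  "exp (2 * of_real pi * of_nat s * of_nat j * \<i> / of_nat t) = unity_root t (int s * int j)"
  by (simp add: unity_root_def cis_conv_exp mult_ac)

section \<open>Rank of a circulant family of vectors\<close>

lemma sum_shift_periodic:
  fixes f :: "nat \<Rightarrow> 'a::ab_group_add"
  assumes "\<And>i. f (i + t) = f i"
  shows "(\<Sum>i<t. f (i + j)) = (\<Sum>i<t. f i)"
proof (induction j)
  case (Suc j)
  have "f j + (\<Sum>i<t. f (i + Suc j)) = (\<Sum>i<Suc t. f (i + j))"
    by (subst sum.lessThan_Suc_shift) simp
  also have "\<dots> = (\<Sum>i<t. f (i + j)) + f j"
    using assms[of j] by (simp add: add.commute)
  finally show ?case using Suc.IH by (simp add: add.commute)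
qed simp

locale complex_vector_space = vector_space scale
  for scale :: "complex \<Rightarrow> 'b::ab_group_add \<Rightarrow> 'b" (infixr "*s" 75)
begin

definition dft :: "nat \<Rightarrow> (nat \<Rightarrow> 'b) \<Rightarrow> nat \<Rightarrow> 'b"
  where "dft t x s = (\<Sum>l<t. unity_root t (- (int s * int l)) *s x l)"

lemma dft_inversion:
  assumes "n < t"
  shows "x n = (1 / of_nat t) *s (\<Sum>s<t. unity_root t (int s * int n) *s dft t x s)"
proof -
  have t: "t > 0" using assms by simp
  have orth: "(\<Sum>s<t. unity_root t (int s * (int n - int l))) = (if l = n then of_nat t else 0)"
    if "l < t" for l
  proof -
    have "int t dvd int n - int l \<longleftrightarrow> l = n"
      using that assms zdvd_imp_le[of "int t" "int n - int l"] zdvd_imp_le[of "int t" "int l - int n"]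
      by (cases l n rule: linorder_cases) (auto simp: dvd_diff_commute)
    thus ?thesis by (simp add: sum_unity_root[OF t])
  qed
  have "(\<Sum>s<t. unity_root t (int s * int n) *s dft t x s)
      = (\<Sum>s<t. \<Sum>l<t. unity_root t (int s * (int n - int l)) *s x l)"
    by (simp add: dft_def scale_sum_right unity_root_add[symmetric] algebra_simps)
  also have "\<dots> = (\<Sum>l<t. (\<Sum>s<t. unity_root t (int s * (int n - int l))) *s x l)"
    by (subst sum.swap) (simp add: scale_sum_left)
  also have "\<dots> = (\<Sum>l<t. if l = n then of_nat t *s x l else 0)"
    by (intro sum.cong) (auto simp: orth)
  also have "\<dots> = of_nat t *s x n"
    using assms by simp
  finally show ?thesis using t by simp
qed

lemma span_dft: "span (dft t x ` {..<t}) = span (x ` {..<t})"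
  unfolding span_eq
proof
  show "dft t x ` {..<t} \<subseteq> span (x ` {..<t})"
    unfolding dft_def by (auto intro: span_sum span_scale span_base)
  show "x ` {..<t} \<subseteq> span (dft t x ` {..<t})"
  proof clarify
    fix n assume "n < t"
    have "(\<Sum>s<t. unity_root t (int s * int n) *s dft t x s) \<in> span (dft t x ` {..<t})"
      by (auto intro!: span_sum span_scale intro: span_base)
    thus "x n \<in> span (dft t x ` {..<t})"
      by (subst dft_inversion[OF \<open>n < t\<close>]) (rule span_scale)
  qed
qed

text \<open>By inversion, the \<open>t\<close> transforms span the \<open>t\<close>-dimensional span of the \<open>x l\<close>, so
  there can be no relation among them and no repetition.\<close>
lemma dft_independent:
  assumes inj: "inj_on x {..<t}" and ind: "independent (x ` {..<t})"
  shows "inj_on (dft t x) {..<t}" and "independent (dft t x ` {..<t})"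
proof -
  let ?D = "dft t x ` {..<t}"
  have dim: "dim ?D = t"
    using span_eq_dim[OF span_dft, of t x] dim_eq_card_independent[OF ind] card_image[OF inj]
    by simp
  have "t \<le> card ?D"
    using dim_le_card'[of ?D] dim by simp
  hence card: "card ?D = card {..<t}"
    using card_image_le[of "{..<t}" "dft t x"] by simp
  thus "inj_on (dft t x) {..<t}"
    by (rule eq_card_imp_inj_on[OF finite_lessThan])
  obtain B where B: "B \<subseteq> ?D" "independent B" "card B = t"
    using basis_exists[of ?D] dim by metis
  have "B = ?D"
    by (rule card_subset_eq) (use B card in auto)
  thus "independent ?D" using B by simp
qed

text \<open>Shifting a periodic family multiplies its transform by a root of unity; hence the
  transform turns a circulant combination into a diagonal one.\<close>
lemma dft_circulant:
  assumes per: "\<And>i. w (i + t) = w i" and t: "t > 0"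
  shows "dft t (\<lambda>i. \<Sum>j<t. a j *s w (i + j)) s
    = (\<Sum>j<t. a j * unity_root t (int s * int j)) *s dft t w s"
proof -
  define f where "f i = unity_root t (- (int s * int i)) *s w i" for i
  have "unity_root t (- (int s * int (i + t))) = unity_root t (- (int s * int i))" for i
    using unity_root_add[of t "- (int s * int i)" "int t * (- int s)"]
      unity_root_multiple[OF t, of "- int s"]
    by (simp add: algebra_simps)
  hence f_per: "f (i + t) = f i" for i
    by (simp only: f_def per)
  have "dft t (\<lambda>i. \<Sum>j<t. a j *s w (i + j)) s
      = (\<Sum>i<t. \<Sum>j<t. (a j * unity_root t (int s * int j)) *s f (i + j))"
    unfolding dft_def f_def
    by (simp add: scale_sum_right unity_root_add[symmetric] mult.assoc algebra_simps)
  also have "\<dots> = (\<Sum>j<t. (a j * unity_root t (int s * int j)) *s (\<Sum>i<t. f (i + j)))"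
    by (subst sum.swap) (simp add: scale_sum_right)
  also have "\<dots> = (\<Sum>j<t. a j * unity_root t (int s * int j)) *s dft t w s"
    by (simp add: sum_shift_periodic[where f = f, OF f_per] scale_sum_left) (simp add: f_def dft_def)
  finally show ?thesis .
qed

text \<open>The family \<open>u i = (\<Sum>j<t. a j *s w (i + j))\<close> and its transform span the same subspace, and
  the transform of \<open>u\<close> is the independent family \<open>dft t w\<close> rescaled by the eigenvalues of the
  circulant matrix. So the members with nonzero eigenvalue are a basis of this subspace.\<close>
lemma dim_span_circulant:
  assumes per: "\<And>i. w (i + t) = w i" and t: "t > 0"
    and inj: "inj_on w {..<t}" and ind: "independent (w ` {..<t})"
  shows "dim (span ((\<lambda>i. \<Sum>j<t. a j *s w (i + j)) ` {..<t}))
    = card {s \<in> {..<t}. (\<Sum>j<t. a j * unity_root t (int s * int j)) \<noteq> 0}"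
    (is "dim (span (?u ` _)) = card ?P")
proof -
  let ?eig = "\<lambda>s. \<Sum>j<t. a j * unity_root t (int s * int j)"
  have u: "dft t ?u s = ?eig s *s dft t w s" for s
    by (rule dft_circulant[where w = w, OF per t])
  have "span (dft t ?u ` {..<t}) = span (dft t w ` ?P)"
    unfolding span_eq
  proof (intro conjI image_subsetI)
    fix s assume "s \<in> {..<t}"
    thus "dft t ?u s \<in> span (dft t w ` ?P)"
      unfolding u by (cases "?eig s = 0") (auto simp: span_zero intro!: span_scale intro: span_base)
  next
    fix s assume s: "s \<in> ?P"
    hence "dft t w s = (1 / ?eig s) *s dft t ?u s"
      unfolding u by simp
    also have "\<dots> \<in> span (dft t ?u ` {..<t})"
      using s by (intro span_scale span_base) auto
    finally show "dft t w s \<in> span (dft t ?u ` {..<t})" .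
  qed
  hence "dim (span (?u ` {..<t})) = dim (span (dft t w ` ?P))"
    by (simp only: span_dft)
  also have "\<dots> = card (dft t w ` ?P)"
    by (rule dim_span_eq_card_independent, rule independent_mono[OF dft_independent(2)[OF inj ind]]) auto
  also have "\<dots> = card ?P"
    by (intro card_image inj_on_subset[OF dft_independent(1)[OF inj ind]]) auto
  finally show ?thesis .
qed

end

section \<open>Independence of the basis tensors\<close>

lemma sum_fun_apply: "(\<Sum>i\<in>A. f i) x = (\<Sum>i\<in>A. f i x)"
  by (induction A rule: infinite_finite_induct) auto

context complex_inner_product_space
begin

lemma multilinear_form_prod_ip:
  "multilinear_form scale m (\<lambda>x. \<Prod>i\<in>{1..m}. ip (x i) (y i))"
  unfolding multilinear_form_def
proof (intro ballI)
  fix v :: "nat \<Rightarrow> 'v" and i assume i: "i \<in> {1..m}"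
  have "(\<Prod>j\<in>{1..m}. ip ((v(i := x)) j) (y j))
      = ip x (y i) * (\<Prod>j\<in>{1..m} - {i}. ip (v j) (y j))" for x
    using i by (subst prod.remove[of _ i]) (auto intro!: prod.cong)
  thus "Vector_Spaces.linear scale (*) (\<lambda>x. \<Prod>j\<in>{1..m}. ip ((v(i := x)) j) (y j))"
    by unfold_locales (simp_all add: ip_add_left ip_scale_left algebra_simps)
qed

text \<open>The products of coordinate functionals form the family dual to the basis tensors.\<close>
lemma basis_tensor_dual:
  assumes e: "orthonormal_basis scale ip k e"
    and \<alpha>: "\<alpha> \<in> index_seqs m k" and \<beta>: "\<beta> \<in> index_seqs m k"
  shows "basis_tensor scale m e \<alpha> (\<lambda>x. \<Prod>i\<in>{1..m}. ip (x i) (e (\<beta> i)))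
    = (if \<alpha> = \<beta> then 1 else 0)"
proof -
  have "basis_tensor scale m e \<alpha> (\<lambda>x. \<Prod>i\<in>{1..m}. ip (x i) (e (\<beta> i)))
      = (\<Prod>i\<in>{1..m}. ip (e (\<alpha> i)) (e (\<beta> i)))"
    using multilinear_form_prod_ip[of m "\<lambda>i. e (\<beta> i)"]
    by (simp add: basis_tensor_def tensor_def)
  also have "\<dots> = (\<Prod>i\<in>{1..m}. if \<alpha> i = \<beta> i then 1 else 0)"
    using e \<alpha> \<beta> unfolding orthonormal_basis_def index_seqs_def
    by (intro prod.cong) (auto simp: PiE_iff)
  also have "\<dots> = (if \<alpha> = \<beta> then 1 else 0)"
  proof (cases "\<alpha> = \<beta>")
    case False
    then obtain i where "i \<in> {1..m}" "\<alpha> i \<noteq> \<beta> i"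
      using \<alpha> \<beta> unfolding index_seqs_def by (meson PiE_ext)
    thus ?thesis using False by (auto intro!: prod_zero)
  qed simp
  finally show ?thesis .
qed

lemma basis_tensors_independent:
  assumes e: "orthonormal_basis scale ip k e"
  shows "inj_on (basis_tensor scale m e) (index_seqs m k)"
    and "\<not> module.dependent tensor_scale (basis_tensor scale m e ` index_seqs m k)"
proof -
  interpret T: vector_space "tensor_scale :: complex \<Rightarrow> 'v tensor \<Rightarrow> 'v tensor"
    by (rule vector_space_tensor_scale)
  let ?b = "basis_tensor scale m e" and ?I = "index_seqs m k"
  let ?F = "\<lambda>\<beta> x. \<Prod>i\<in>{1..m}. ip (x i) (e (\<beta> i))"
  have fin: "finite ?I" unfolding index_seqs_def by (intro finite_PiE) auto
  show inj: "inj_on ?b ?I"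
  proof (rule inj_onI)
    fix \<alpha> \<beta> assume "\<alpha> \<in> ?I" "\<beta> \<in> ?I" "?b \<alpha> = ?b \<beta>"
    hence "(if \<alpha> = \<beta> then 1 else 0) = (1 :: complex)"
      using basis_tensor_dual[OF e, of \<alpha> m \<beta>] basis_tensor_dual[OF e, of \<beta> m \<beta>] by simp
    thus "\<alpha> = \<beta>" by (simp split: if_splits)
  qed
  have zero: "c x = 0"
    if rel: "(\<Sum>x\<in>?b ` ?I. tensor_scale (c x) x) = 0" and "x \<in> ?b ` ?I" for c x
  proof -
    from that(2) obtain \<beta> where \<beta>: "\<beta> \<in> ?I" "x = ?b \<beta>" by auto
    have at_dual: "tensor_scale (c (?b \<alpha>)) (?b \<alpha>) (?F \<beta>) = (if \<alpha> = \<beta> then c (?b \<alpha>) else 0)"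
      if "\<alpha> \<in> ?I" for \<alpha>
      by (simp only: tensor_scale_def basis_tensor_dual[OF e that \<beta>(1)]) simp
    have "0 = (\<Sum>\<alpha>\<in>?I. tensor_scale (c (?b \<alpha>)) (?b \<alpha>)) (?F \<beta>)"
      using rel by (simp add: sum.reindex[OF inj])
    also have "\<dots> = (\<Sum>\<alpha>\<in>?I. (if \<alpha> = \<beta> then c (?b \<alpha>) else 0))"
      unfolding sum_fun_apply by (intro sum.cong refl at_dual)
    also have "\<dots> = c x"
      using \<beta> fin by simp
    finally show ?thesis by simp
  qed
  show "\<not> T.dependent (?b ` ?I)"
  proof
    assume "T.dependent (?b ` ?I)"
    then obtain c x where "x \<in> ?b ` ?I" "c x \<noteq> 0" "(\<Sum>x\<in>?b ` ?I. tensor_scale (c x) x) = 0"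
      unfolding T.dependent_finite[OF finite_imageI[OF fin]] by blast
    thus False using zero[of c x] by simp
  qed
qed

end

section \<open>Coordinates of the symmetrized tensors\<close>

lemma index_seqs_comp_permutes:
  assumes "\<alpha> \<in> index_seqs m k" and "\<sigma> permutes {1..m}"
  shows "\<alpha> \<circ> \<sigma> \<in> index_seqs m k"
  using assms permutes_in_image[OF assms(2)]
  by (auto simp: index_seqs_def PiE_iff extensional_def permutes_def)

lemma mem_coset_rel:
  assumes C: "subgroup C (sym_group m)" "C \<subseteq> G"
  shows "(\<sigma>, \<rho>) \<in> coset_rel G C \<gamma> \<longleftrightarrow> \<sigma> \<in> C \<and> \<rho> \<in> C \<and> \<gamma> \<circ> \<sigma> = \<gamma> \<circ> \<rho>"
proof (cases "\<sigma> \<in> C \<and> \<rho> \<in> C")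
  case True
  hence perm: "\<rho> permutes {1..m}"
    using subgroup.subset[OF C(1)] sym_group_carrier by blast
  have "\<sigma> \<circ> inv' \<rho> \<in> C"
    using True subgroup.m_closed[OF C(1), of \<sigma> "inv' \<rho>"] subgroup.m_inv_closed[OF C(1), of \<rho>]
      perm sym_group_carrier[of \<rho> m] by (simp add: sym_group_mult)
  moreover have "\<gamma> \<circ> (\<sigma> \<circ> inv' \<rho>) = \<gamma> \<longleftrightarrow> \<gamma> \<circ> \<sigma> = \<gamma> \<circ> \<rho>"
    using permutes_inv_o[OF perm] by (metis comp_assoc comp_id)
  ultimately show ?thesis
    using True C(2) by (auto simp: coset_rel_def seq_stabilizer_def)
qed (auto simp: coset_rel_def)

lemma subgroup_generate_singleton:
  assumes "\<tau> permutes {1..m}"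
  shows "subgroup (generate (sym_group m) {\<tau>}) (sym_group m)"
  using assms sym_group_carrier[of \<tau> m]
  by (intro group.generate_is_subgroup[OF sym_group_is_group]) auto

lemma funpow_mem_generate: "\<tau> ^^ n \<in> generate (sym_group m) {\<tau>}"
proof (induction n)
  case 0
  show ?case using generate.one[of "sym_group m" "{\<tau>}"] by (simp add: sym_group_one id_def)
next
  case (Suc n)
  have "\<tau> \<in> generate (sym_group m) {\<tau>}" by (rule generate.incl) simp
  from generate.eng[OF this Suc] show ?case by (simp add: sym_group_mult del: o_apply)
qed

text \<open>The permutations commuting with \<open>\<tau>\<close> are closed under products and inverses.\<close>
lemma generate_singleton_commute:
  assumes "\<tau> permutes {1..m}" and "\<sigma> \<in> generate (sym_group m) {\<tau>}"
  shows "\<sigma> \<circ> \<tau> ^^ n = \<tau> ^^ n \<circ> \<sigma>"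
proof -
  have "\<sigma> \<circ> \<tau> = \<tau> \<circ> \<sigma>"
    using assms(2)
  proof (induction rule: generate.induct)
    case (inv h)
    thus ?case
      using assms(1) permutes_inv_o[OF assms(1)] sym_group_carrier[of \<tau> m] by simp
  next
    case (eng g h)
    thus ?case by (metis comp_assoc sym_group_mult)
  qed (auto simp: sym_group_one)
  thus ?thesis
  proof (induction n)
    case (Suc n)
    thus ?case by (metis comp_assoc funpow.simps(2))
  qed simp
qed

text \<open>Here \<open>\<gamma> \<circ> \<tau> ^^ 1, \<dots>, \<gamma> \<circ> \<tau> ^^ t\<close> lists the orbit of \<open>\<gamma>\<close> under the cyclic group \<open>C\<close>
  without repetition.\<close>
locale cyclic_orbit =
  fixes m t :: nat and C G :: "(nat \<Rightarrow> nat) set" and \<tau> \<gamma> :: "nat \<Rightarrow> nat"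
  assumes \<tau>: "\<tau> permutes {1..m}"
    and C_def: "C = generate (sym_group m) {\<tau>}"
    and C_sub: "C \<subseteq> G"
    and orbit: "\<And>\<sigma>. \<sigma> \<in> C \<Longrightarrow> \<exists>j\<in>{1..t}. \<gamma> \<circ> \<sigma> = \<gamma> \<circ> \<tau> ^^ j"
    and inj: "inj_on (\<lambda>j. \<gamma> \<circ> \<tau> ^^ j) {1..t}"
begin

abbreviation "H \<equiv> C \<inter> seq_stabilizer G \<gamma>"

lemma C_subgroup: "subgroup C (sym_group m)"
  unfolding C_def by (rule subgroup_generate_singleton[OF \<tau>])

lemma C_permutes: "\<sigma> \<in> C \<Longrightarrow> \<sigma> permutes {1..m}"
  using subgroup.subset[OF C_subgroup] sym_group_carrier by blast

lemma finite_C: "finite C"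
  using C_permutes by (intro finite_subset[OF _ finite_permutations[of "{1..m}"]]) auto

lemma id_mem: "id \<in> C"
  using subgroup.one_closed[OF C_subgroup] by (simp add: sym_group_one)

lemma comp_mem: "\<sigma> \<in> C \<Longrightarrow> \<rho> \<in> C \<Longrightarrow> \<sigma> \<circ> \<rho> \<in> C"
  using subgroup.m_closed[OF C_subgroup] by (simp add: sym_group_mult)

lemma inv_mem: "\<sigma> \<in> C \<Longrightarrow> inv' \<sigma> \<in> C"
  using subgroup.m_inv_closed[OF C_subgroup, of \<sigma>] subgroup.mem_carrier[OF C_subgroup, of \<sigma>]
  by simp

lemma pow_mem: "\<tau> ^^ n \<in> C"
  unfolding C_def by (rule funpow_mem_generate)

lemma commute: "\<sigma> \<in> C \<Longrightarrow> \<sigma> \<circ> \<tau> ^^ n = \<tau> ^^ n \<circ> \<sigma>"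
  using generate_singleton_commute[OF \<tau>] C_def by blast

lemma mem_H: "h \<in> H \<longleftrightarrow> h \<in> C \<and> \<gamma> \<circ> h = \<gamma>"
  using C_sub by (auto simp: seq_stabilizer_def)

lemma t_pos: "t > 0"
  using orbit[OF id_mem] by auto

text \<open>The sequence \<open>\<gamma> \<circ> \<tau> ^^ (t + 1)\<close> already occurs as some \<open>\<gamma> \<circ> \<tau> ^^ j\<close> with \<open>1 \<le> j \<le> t\<close>.
  Cancelling one \<open>\<tau>\<close> shows that \<open>j > 1\<close> would be a repetition among the first \<open>t\<close> terms.\<close>
lemma pow_t_stabilizes: "\<gamma> \<circ> \<tau> ^^ t = \<gamma>"
proof -
  obtain j where j: "j \<in> {1..t}" "\<gamma> \<circ> \<tau> ^^ Suc t = \<gamma> \<circ> \<tau> ^^ j"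
    using orbit[OF pow_mem] by blast
  then obtain n where n: "j = Suc n" by (cases j) auto
  have "(\<gamma> \<circ> \<tau> ^^ t) \<circ> \<tau> = (\<gamma> \<circ> \<tau> ^^ n) \<circ> \<tau>"
    using j(2) unfolding n by (simp only: funpow_Suc_right comp_assoc)
  hence eq: "\<gamma> \<circ> \<tau> ^^ t = \<gamma> \<circ> \<tau> ^^ n"
    using permutes_inv_o(1)[OF \<tau>] by (metis comp_assoc comp_id)
  have "n = 0"
  proof (rule ccontr)
    assume "n \<noteq> 0"
    hence "t = n" using j(1) n t_pos by (intro inj_onD[OF inj eq]) auto
    thus False using j(1) n by simp
  qed
  thus ?thesis using eq by (simp flip: id_def)
qed

lemma orbit_periodic: "\<gamma> \<circ> \<tau> ^^ (n + t) = \<gamma> \<circ> \<tau> ^^ n"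
  using pow_t_stabilizes by (metis add.commute comp_assoc funpow_add)

lemma orbit_inj: "inj_on (\<lambda>j. \<gamma> \<circ> \<tau> ^^ j) {..<t}"
proof (rule inj_onI)
  fix i j assume ij: "i \<in> {..<t}" "j \<in> {..<t}" and "\<gamma> \<circ> \<tau> ^^ i = \<gamma> \<circ> \<tau> ^^ j"
  hence "\<gamma> \<circ> \<tau> ^^ Suc i = \<gamma> \<circ> \<tau> ^^ Suc j"
    by (simp only: funpow_Suc_right comp_assoc[symmetric])
  from inj_onD[OF inj this] ij show "i = j" by auto
qed

lemma orbit_image: "(\<lambda>g. \<gamma> \<circ> g) ` C = (\<lambda>i. \<gamma> \<circ> \<tau> ^^ i) ` {..<t}"
proof (intro equalityI subsetI)
  fix x assume "x \<in> (\<lambda>g. \<gamma> \<circ> g) ` C"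
  then obtain j where j: "j \<in> {1..t}" "x = \<gamma> \<circ> \<tau> ^^ j" using orbit by blast
  show "x \<in> (\<lambda>i. \<gamma> \<circ> \<tau> ^^ i) ` {..<t}"
  proof (cases "j = t")
    case True
    hence "x = \<gamma> \<circ> \<tau> ^^ 0" using j orbit_periodic[of 0] by simp
    thus ?thesis using t_pos by blast
  qed (use j in auto)
qed (use pow_mem in auto)

text \<open>The powers of \<open>\<tau>\<close> represent the cosets of the stabilizer in \<open>C\<close>. The exponent \<open>t - j\<close>
  makes the coset of index \<open>j\<close> shift the orbit forward by \<open>j\<close> when its elements are inverted.\<close>
lemma coset_decomposition:
  "bij_betw (\<lambda>(h, j). h \<circ> \<tau> ^^ (t - j)) (H \<times> {..<t}) C"
  unfolding bij_betw_def
proof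
  show "inj_on (\<lambda>(h, j). h \<circ> \<tau> ^^ (t - j)) (H \<times> {..<t})"
  proof (rule inj_onI, clarify)
    fix h i h' j
    assume h: "h \<in> C" "h \<in> seq_stabilizer G \<gamma>" "h' \<in> C" "h' \<in> seq_stabilizer G \<gamma>"
      and ij: "i < t" "j < t" and eq: "h \<circ> \<tau> ^^ (t - i) = h' \<circ> \<tau> ^^ (t - j)"
    have "\<gamma> \<circ> h = \<gamma>" "\<gamma> \<circ> h' = \<gamma>" using h mem_H by auto
    hence "\<gamma> \<circ> \<tau> ^^ (t - i) = \<gamma> \<circ> \<tau> ^^ (t - j)"
      using eq by (metis comp_assoc)
    hence "t - i = t - j" using ij by (intro inj_onD[OF inj]) auto
    hence "i = j" using ij by simp
    moreover have "h = h'"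
      using eq permutes_inv_o(1)[OF C_permutes[OF pow_mem]] unfolding \<open>t - i = t - j\<close>
      by (metis comp_assoc comp_id)
    ultimately show "h = h' \<and> i = j" by simp
  qed
  show "(\<lambda>(h, j). h \<circ> \<tau> ^^ (t - j)) ` (H \<times> {..<t}) = C"
  proof (intro equalityI subsetI)
    fix \<sigma> assume \<sigma>: "\<sigma> \<in> C"
    then obtain j where j: "j \<in> {1..t}" "\<gamma> \<circ> \<sigma> = \<gamma> \<circ> \<tau> ^^ j" using orbit by blast
    define h where "h = \<sigma> \<circ> inv' (\<tau> ^^ j)"
    have perm: "\<tau> ^^ j permutes {1..m}" by (rule C_permutes[OF pow_mem])
    have "\<gamma> \<circ> h = \<gamma>"
      unfolding h_def using j(2) permutes_inv_o(1)[OF perm] by (metis comp_assoc comp_id)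
    hence "h \<in> H" unfolding mem_H h_def using \<sigma> pow_mem comp_mem inv_mem by blast
    moreover have "\<sigma> = h \<circ> \<tau> ^^ (t - (t - j))"
      unfolding h_def using j(1) permutes_inv_o(2)[OF perm] by (simp add: comp_assoc)
    ultimately show "\<sigma> \<in> (\<lambda>(h, j). h \<circ> \<tau> ^^ (t - j)) ` (H \<times> {..<t})"
      using j(1) by (intro image_eqI[of _ _ "(h, t - j)"]) auto
  qed (use pow_mem comp_mem in auto)
qed

lemma card_C: "card C = card H * t"
  using bij_betw_same_card[OF coset_decomposition] by (simp add: card_cartesian_product)

lemma card_H_pos: "card H > 0"
  using finite_C id_mem mem_H[of id] by (auto simp: card_gt_0_iff)

lemma orbit_comp_inv:
  assumes h: "h \<in> H" and j: "j < t"
  shows "\<gamma> \<circ> \<tau> ^^ i \<circ> inv' (h \<circ> \<tau> ^^ (t - j)) = \<gamma> \<circ> \<tau> ^^ (i + j)"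
proof -
  let ?\<sigma> = "h \<circ> \<tau> ^^ (t - j)"
  have hC: "h \<in> C" and h\<gamma>: "\<gamma> \<circ> h = \<gamma>" using h mem_H by auto
  have "(\<gamma> \<circ> \<tau> ^^ (i + j)) \<circ> ?\<sigma> = (\<gamma> \<circ> h) \<circ> (\<tau> ^^ (i + j) \<circ> \<tau> ^^ (t - j))"
    using commute[OF hC] by (metis comp_assoc)
  also have "\<dots> = \<gamma> \<circ> \<tau> ^^ (i + t)"
    using j by (simp add: h\<gamma> flip: funpow_add)
  also have "\<dots> = \<gamma> \<circ> \<tau> ^^ i" by (rule orbit_periodic)
  finally have "\<gamma> \<circ> \<tau> ^^ i = (\<gamma> \<circ> \<tau> ^^ (i + j)) \<circ> ?\<sigma>" ..
  moreover have "?\<sigma> permutes {1..m}"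
    using C_permutes comp_mem hC pow_mem by blast
  ultimately show ?thesis
    using permutes_inv_o(1) by (metis comp_assoc comp_id)
qed

text \<open>Grouping the terms of the symmetrized tensor by cosets of the stabilizer exhibits it
  as a circulant combination of the basis tensors along the orbit.\<close>
lemma sym_tensor_circulant:
  assumes S: "finite S" "C \<subseteq> S" and \<phi>: "\<forall>\<sigma>\<in>S - C. \<phi> \<sigma> = 0"
  shows "sym_tensor scale m e S \<phi> (\<gamma> \<circ> \<tau> ^^ i) =
    (\<Sum>j<t. tensor_scale (\<phi> id / of_nat (card S) * (\<Sum>h\<in>H. \<phi> (h \<circ> \<tau> ^^ (t - j))))
      (basis_tensor scale m e (\<gamma> \<circ> \<tau> ^^ (i + j))))"
proof -
  interpret T: vector_space "tensor_scale :: complex \<Rightarrow> 'b tensor \<Rightarrow> 'b tensor"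
    by (rule vector_space_tensor_scale)
  let ?w = "\<lambda>n. basis_tensor scale m e (\<gamma> \<circ> \<tau> ^^ n)"
  let ?F = "\<lambda>\<sigma>. tensor_scale (\<phi> \<sigma>) (basis_tensor scale m e (\<gamma> \<circ> \<tau> ^^ i \<circ> inv' \<sigma>))"
  have "sum ?F S = sum ?F C"
    using S \<phi> by (intro sum.mono_neutral_right) auto
  also have "\<dots> = (\<Sum>(h, j)\<in>H \<times> {..<t}. ?F (h \<circ> \<tau> ^^ (t - j)))"
    by (subst sum.reindex_bij_betw[OF coset_decomposition, symmetric]) (simp add: case_prod_beta)
  also have "\<dots> = (\<Sum>(h, j)\<in>H \<times> {..<t}. tensor_scale (\<phi> (h \<circ> \<tau> ^^ (t - j))) (?w (i + j)))"
    by (intro sum.cong) (auto simp: orbit_comp_inv)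
  also have "\<dots> = (\<Sum>j<t. tensor_scale (\<Sum>h\<in>H. \<phi> (h \<circ> \<tau> ^^ (t - j))) (?w (i + j)))"
    by (subst sum.cartesian_product[symmetric], subst sum.swap) (simp add: T.scale_sum_left)
  finally show ?thesis
    unfolding sym_tensor_def by (simp add: T.scale_sum_right)
qed

end

text \<open>Equivalence classes in \<open>C\<close> correspond to the points of the orbit of \<open>\<gamma>\<close>, so distinct and
  exhaustive classes amount to distinct and exhaustive points.\<close>
lemma coset_classes_orbit:
  assumes C: "subgroup C (sym_group m)" "C \<subseteq> G" and pow: "\<And>j. \<tau> ^^ j \<in> C"
    and classes: "C // coset_rel G C \<gamma> = {coset_rel G C \<gamma> `` {\<tau> ^^ j} | j. j \<in> {1..t}}"
    and distinct: "inj_on (\<lambda>j. coset_rel G C \<gamma> `` {\<tau> ^^ j}) {1..t}"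
  shows "\<sigma> \<in> C \<Longrightarrow> \<exists>j\<in>{1..t}. \<gamma> \<circ> \<sigma> = \<gamma> \<circ> \<tau> ^^ j"
    and "inj_on (\<lambda>j. \<gamma> \<circ> \<tau> ^^ j) {1..t}"
proof -
  let ?R = "coset_rel G C \<gamma>"
  have R: "\<rho> \<in> ?R `` {\<sigma>} \<longleftrightarrow> \<sigma> \<in> C \<and> \<rho> \<in> C \<and> \<gamma> \<circ> \<sigma> = \<gamma> \<circ> \<rho>" for \<sigma> \<rho>
    using mem_coset_rel[OF C] by simp
  show "\<exists>j\<in>{1..t}. \<gamma> \<circ> \<sigma> = \<gamma> \<circ> \<tau> ^^ j" if \<sigma>: "\<sigma> \<in> C"
  proof -
    have "?R `` {\<sigma>} \<in> C // ?R" using \<sigma> by (rule quotientI)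
    then obtain j where "j \<in> {1..t}" "?R `` {\<sigma>} = ?R `` {\<tau> ^^ j}"
      unfolding classes by blast
    moreover have "\<sigma> \<in> ?R `` {\<sigma>}" using \<sigma> R by blast
    ultimately show ?thesis using R by metis
  qed
  show "inj_on (\<lambda>j. \<gamma> \<circ> \<tau> ^^ j) {1..t}"
  proof (rule inj_onI)
    fix i j assume ij: "i \<in> {1..t}" "j \<in> {1..t}" and eq: "\<gamma> \<circ> \<tau> ^^ i = \<gamma> \<circ> \<tau> ^^ j"
    have "?R `` {\<tau> ^^ i} = ?R `` {\<tau> ^^ j}"
      by (rule Set.set_eqI) (simp only: R eq pow)
    from inj_onD[OF distinct this] ij show "i = j" by simp
  qed
qed

section \<open>The dimension formula\<close>

theorem theorem3p4:
  fixes m k t d :: nat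
    and G S C \<Delta> :: "(nat \<Rightarrow> nat) set"
    and \<phi> :: "(nat \<Rightarrow> nat) \<Rightarrow> complex"
    and \<tau> \<gamma> :: "nat \<Rightarrow> nat"
    and scale :: "complex \<Rightarrow> 'v::ab_group_add \<Rightarrow> 'v"
    and ip :: "'v \<Rightarrow> 'v \<Rightarrow> complex"
    and e :: "nat \<Rightarrow> 'v"
    and v :: "nat \<Rightarrow> complex"
  assumes G: "subgroup G (sym_group m)"
    and S: "S \<subseteq> G" "id \<in> S"
    and V: "complex_inner_product_space scale ip"
    and dim_V: "vector_space.dim scale (UNIV :: 'v set) = k"
    and e: "orthonormal_basis scale ip k e"
    and \<Delta>: "orbit_representatives G m k \<Delta>"
    and C: "\<tau> \<in> G" "C = generate (sym_group m) {\<tau>}"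
    and supp: "group_support S \<phi> C"
    and \<gamma>: "\<gamma> \<in> \<Delta>"
    and classes: "C // coset_rel G C \<gamma> = {coset_rel G C \<gamma> `` {\<tau> ^^ j} | j. j \<in> {1..t}}"
    and classes_distinct: "inj_on (\<lambda>j. coset_rel G C \<gamma> `` {\<tau> ^^ j}) {1..t}"
    and v: "\<And>j. j < t \<Longrightarrow> v j = (\<Sum>h\<in>C \<inter> seq_stabilizer G \<gamma>. \<phi> (h \<circ> \<tau> ^^ (t - j)))"
    and d: "d = card {s \<in> {0..<t}.
              (\<Sum>j = 0..<t. v j * exp (2 * of_real pi * of_nat s * of_nat j * \<i> / of_nat t)) = 0}"
  shows "real t = real (card C) / real (card (C \<inter> seq_stabilizer G \<gamma>)) \<and>
    int (vector_space.dim tensor_scale (orbital_subspace scale m e S \<phi> \<gamma> C)) = int t - int d"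
proof -
  interpret V: complex_inner_product_space scale ip by (rule V)
  interpret T: complex_vector_space "tensor_scale :: complex \<Rightarrow> 'v tensor \<Rightarrow> 'v tensor"
    by (intro complex_vector_space.intro vector_space_tensor_scale)
  have CS: "C \<subseteq> S" and \<phi>0: "\<forall>\<sigma>\<in>S - C. \<phi> \<sigma> = 0" and \<phi>n0: "\<And>\<sigma>. \<sigma> \<in> C \<Longrightarrow> \<phi> \<sigma> \<noteq> 0"
    using supp by (auto simp: group_support_def)
  have CG: "C \<subseteq> G" using CS S(1) by blast
  have G_perm: "\<sigma> permutes {1..m}" if "\<sigma> \<in> G" for \<sigma>
    using that subgroup.subset[OF G] sym_group_carrier by blast
  have \<tau>: "\<tau> permutes {1..m}" using G_perm C(1) .
  have C_sub: "subgroup C (sym_group m)"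
    unfolding C(2) by (rule subgroup_generate_singleton[OF \<tau>])
  have pow: "\<tau> ^^ j \<in> C" for j
    unfolding C(2) by (rule funpow_mem_generate)
  interpret cyclic_orbit m t C G \<tau> \<gamma>
    using \<tau> C(2) CG coset_classes_orbit[OF C_sub CG pow classes classes_distinct]
    by unfold_locales auto
  have finS: "finite S"
    using S(1) G_perm by (intro finite_subset[OF _ finite_permutations[of "{1..m}"]]) auto
  have \<gamma>I: "\<gamma> \<in> index_seqs m k" using \<Delta> \<gamma> by (auto simp: orbit_representatives_def)
  \<comment> \<open>This normalising factor scales every eigenvalue, so it must not vanish.\<close>
  define c where "c = \<phi> id / of_nat (card S)"
  have c: "c \<noteq> 0" unfolding c_def using \<phi>n0[OF id_mem] finS S(2) by auto
  define w where "w n = basis_tensor scale m e (\<gamma> \<circ> \<tau> ^^ n)" for n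
  have orb: "\<gamma> \<circ> \<tau> ^^ n \<in> index_seqs m k" for n
    by (rule index_seqs_comp_permutes[OF \<gamma>I C_permutes[OF pow]])
  have w_per: "w (n + t) = w n" for n unfolding w_def orbit_periodic ..
  have w_inj: "inj_on w {..<t}"
    using orbit_inj V.basis_tensors_independent(1)[OF e, of m] orb
    unfolding w_def inj_on_def by blast
  have w_ind: "T.independent (w ` {..<t})"
    using orb by (intro T.independent_mono[OF V.basis_tensors_independent(2)[OF e, of m]])
      (auto simp: w_def)
  let ?u = "\<lambda>i. \<Sum>j<t. tensor_scale (c * v j) (w (i + j))"
  have u: "sym_tensor scale m e S \<phi> (\<gamma> \<circ> \<tau> ^^ i) = ?u i" for i
    unfolding sym_tensor_circulant[OF finS CS \<phi>0] w_def c_def by (intro sum.cong) (simp_all add: v)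
  have "{sym_tensor scale m e S \<phi> (\<gamma> \<circ> g) | g. g \<in> C}
      = sym_tensor scale m e S \<phi> ` ((\<lambda>g. \<gamma> \<circ> g) ` C)"
    by auto
  also have "\<dots> = ?u ` {..<t}"
    unfolding orbit_image image_image u ..
  finally have sub: "orbital_subspace scale m e S \<phi> \<gamma> C = T.span (?u ` {..<t})"
    unfolding orbital_subspace_def by simp
  let ?eig = "\<lambda>s. \<Sum>j = 0..<t. v j * exp (2 * of_real pi * of_nat s * of_nat j * \<i> / of_nat t)"
  have eig: "(\<Sum>j<t. c * v j * unity_root t (int s * int j)) = c * ?eig s" for s
    unfolding exp_eq_unity_root by (simp add: sum_distrib_left mult.assoc atLeast0LessThan)
  have dim: "T.dim (orbital_subspace scale m e S \<phi> \<gamma> C) = card {s \<in> {0..<t}. ?eig s \<noteq> 0}"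
    unfolding sub T.dim_span_circulant[where w = w, OF w_per t_pos w_inj w_ind] eig
    using c by (simp add: atLeast0LessThan)
  have split: "t = card {s \<in> {0..<t}. P s} + card {s \<in> {0..<t}. \<not> P s}" for P :: "nat \<Rightarrow> bool"
  proof -
    have "{0..<t} = {s \<in> {0..<t}. P s} \<union> {s \<in> {0..<t}. \<not> P s}" by blast
    hence "card {0..<t} = card ({s \<in> {0..<t}. P s} \<union> {s \<in> {0..<t}. \<not> P s})"
      by (rule arg_cong)
    also have "\<dots> = card {s \<in> {0..<t}. P s} + card {s \<in> {0..<t}. \<not> P s}"
      by (rule card_Un_disjoint) auto
    finally show ?thesis by simp
  qed
  have "t = d + card {s \<in> {0..<t}. ?eig s \<noteq> 0}"
    unfolding d by (rule split)
  hence "int (T.dim (orbital_subspace scale m e S \<phi> \<gamma> C)) = int t - int d"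
    unfolding dim by linarith
  moreover have "real t = real (card C) / real (card H)"
    using card_C card_H_pos by simp
  ultimately show ?thesis by simp
qed

end
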